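(* Let $n\in\mathbb{N}$ and $r\in\mathbb{Z}$. The circle of partition $\mathcal{C}(n)$ remains invariant under the $r$-th level rotation $\varpi_r$; that is, $\varpi_r:\mathcal{C}(n)\to\mathcal{C}(n)$, so that $\mathcal{C}^r(n)=\mathcal{C}(n)$.
   Context: $\mathbb{N}$ is the set of positive integers. For $\mathbb{M}\subseteq\mathbb{N}$ and $n\in\mathbb{N}$, the circle of partition (CoP) is $\mathcal{C}(n,\mathbb{M})=\{[x]: x,y\in\mathbb{M},\ x+y=n\}$; points $[x]$ are identified by their weight $x$; $\mathcal{C}(n)=\mathcal{C}(n,\mathbb{N})$. For $r\in\mathbb{Z}$, the $r$-th level rotation is the map $\varpi_r:\mathcal{C}(n,\mathbb{M})\to\mathcal{C}^r(n,\mathbb{M})$, where $\mathcal{C}^r(n,\mathbb{M})$ is the set of points $[k]\in\mathcal{C}(n,\mathbb{M})$ such that, for some $[x]\in\mathcal{C}(n,\mathbb{M})$, $k$ is the residue of $x+r$ modulo $n$ if $x+r\not\equiv 0\pmod n$, and $k$ is the residue of $n+r$ modulo $n$ if $x+r\equiv 0\pmod n$ (residues taken in $\{0,1,\dots,n-1\}$). Write $\mathcal{C}^r(n)=\mathcal{C}^r(n,\mathbb{N})$. *)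

theory Defs
  imports "HOL-Number_Theory.Cong" "HOL-Library.FuncSet"
begin

(* The set of positive integers; points [x] of a circle of partition are
   represented by their weights x. *)
abbreviation pos_nats :: "nat set" where
  "pos_nats \<equiv> {n. 0 < n}"

definition CoP :: "nat \<Rightarrow> nat set \<Rightarrow> nat set" where
  "CoP n M = {x \<in> M. \<exists>y\<in>M. x + y = n}"

(* For n > 0 the residues lie in {0..n-1}, so nat does not truncate, also for
   negative r. *)
definition level_rot :: "nat \<Rightarrow> int \<Rightarrow> nat \<Rightarrow> nat" where
  "level_rot n r x =
     (if [int x + r = 0] (mod int n) then nat ((int n + r) mod int n)
      else nat ((int x + r) mod int n))"

(* The set C^r(n,M): by definition only those images that are points of C(n,M). *)
definition CoP_rot :: "int \<Rightarrow> nat \<Rightarrow> nat set \<Rightarrow> nat set" where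
  "CoP_rot r n M = {k \<in> CoP n M. \<exists>x \<in> CoP n M. k = level_rot n r x}"

end

theory Submission
  imports Defs
begin

text \<open>
  The circle \<open>\<C>(n)\<close> consists of the nonzero residues modulo \<open>n\<close>. The translation by \<open>r\<close> permutes all
  residues, and the only way it can leave the circle is through the residue \<open>0\<close>. The level rotation
  closes this gap: the point that would be sent to \<open>0\<close> is sent to the image \<open>r\<close> of \<open>0\<close> instead. It is
  therefore the first return map of the translation to the nonzero residues, and such a map is again
  a permutation. If \<open>r \<equiv> 0\<close>, no nonzero residue is sent to \<open>0\<close>, so the value \<open>r\<close> is used only when it
  is itself a point of the circle.
\<close>

lemma CoP_pos_nats: "CoP n pos_nats = {0<..<n}"
proof (intro equalityI subsetI)
  fix x assume "x \<in> {0<..<n}"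
  then have "x \<in> pos_nats" "n - x \<in> pos_nats" "x + (n - x) = n" by auto
  then show "x \<in> CoP n pos_nats" unfolding CoP_def by blast
qed (auto simp: CoP_def)

lemma level_rot_eq:
  "level_rot n r x =
     (if (int x + r) mod int n = 0 then nat (r mod int n) else nat ((int x + r) mod int n))"
  by (simp add: level_rot_def cong_def)

lemma nat_mod_in_circle:
  assumes "0 < n" "a mod int n \<noteq> 0"
  shows "nat (a mod int n) \<in> {0<..<n}"
proof -
  have "0 \<le> a mod int n" "a mod int n < int n" using assms(1) by simp_all
  with assms(2) show ?thesis by auto
qed

lemma level_rot_in_circle:
  assumes "x \<in> {0<..<n}"
  shows "level_rot n r x \<in> {0<..<n}"
proof (cases "(int x + r) mod int n = 0")
  case True
  \<comment> \<open>Were \<open>r\<close> divisible by \<open>n\<close>, then so would be \<open>x\<close>, which lies strictly between \<open>0\<close> and \<open>n\<close>.\<close>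
  have "r mod int n \<noteq> 0"
  proof
    assume "r mod int n = 0"
    then have "int x mod int n = (int x + r) mod int n"
      using mod_add_right_eq[of "int x" r "int n"] by simp
    with True assms show False by simp
  qed
  with True assms show ?thesis unfolding level_rot_eq using nat_mod_in_circle[of n] by simp
next
  case False
  with assms show ?thesis unfolding level_rot_eq using nat_mod_in_circle[of n] by simp
qed

text \<open>
  The natural preimage of \<open>k\<close> is \<open>k - r\<close>. It fails to be a point of the circle exactly when
  \<open>k \<equiv> r\<close>; then \<open>k\<close> is reached by the detour around \<open>0\<close>, from \<open>-r\<close>, that is from \<open>n - k\<close>.
\<close>

lemma level_rot_onto_circle:
  assumes "k \<in> {0<..<n}"
  obtains x where "x \<in> {0<..<n}" "k = level_rot n r x"
proof (cases "(int k - r) mod int n = 0")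
  case True
  then have "[int k = r] (mod int n)" by (simp add: cong_iff_dvd_diff mod_eq_0_iff_dvd)
  then have r: "r mod int n = int k" using assms by (simp add: cong_def)
  have "(int (n - k) + r) mod int n = (int (n - k) + int k) mod int n"
    using mod_add_right_eq[of "int (n - k)" r "int n"] by (simp add: r)
  also have "\<dots> = 0" using assms by (simp add: of_nat_diff)
  finally have "k = level_rot n r (n - k)" by (simp add: level_rot_eq r)
  moreover have "n - k \<in> {0<..<n}" using assms by auto
  ultimately show thesis using that by blast
next
  case False
  define x where "x = nat ((int k - r) mod int n)"
  have x: "x \<in> {0<..<n}" unfolding x_def using False assms by (intro nat_mod_in_circle) auto
  have "int x = (int k - r) mod int n" unfolding x_def using assms by simp
  then have "(int x + r) mod int n = int k" using assms by (simp add: mod_simps)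
  then have "k = level_rot n r x" using assms by (simp add: level_rot_eq)
  with x show thesis using that by blast
qed

theorem theorem2p23:
  fixes n :: nat and r :: int
  assumes "n \<in> pos_nats"
  shows "level_rot n r \<in> CoP n pos_nats \<rightarrow> CoP n pos_nats
       \<and> CoP_rot r n pos_nats = CoP n pos_nats"
proof
  show "level_rot n r \<in> CoP n pos_nats \<rightarrow> CoP n pos_nats"
    unfolding CoP_pos_nats using level_rot_in_circle by blast
  show "CoP_rot r n pos_nats = CoP n pos_nats"
    unfolding CoP_rot_def CoP_pos_nats using level_rot_onto_circle by blast
qed

end
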